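(* Let $d\ge 2$, $n\ge d$ and $k\ge 1$ be integers, and put $c=\left\lceil n/\sum_{j=0}^k d^j\right\rceil$. Suppose there exist a vertex $x\in\{0,\dots,n-1\}$ of $G_B(n,d)$ and an integer $h$ with $$(d-1)x\equiv c-h \pmod n \qquad\text{and}\qquad 0\le \Big(\sum_{j=0}^{k-1} d^j\Big)h \le \Big(\sum_{j=0}^k d^j\Big)c - n.$$ Then $\gamma_k(G_B(n,d)) = c$, and $D=\{x,x+1,\dots,x+c-1\}$ (taken modulo $n$) is a minimum distance $k$-dominating set of $G_B(n,d)$.
   Context: The generalized de Bruijn digraph $G_B(n,d)$ has vertex set $\{0,1,\dots,n-1\}$ and an arc $(x,y)$ whenever $y\equiv dx+i \pmod n$ for some $0\le i\le d-1$ (self-loops allowed). A set $D\subseteq V(G)$ of a digraph $G$ is a distance $k$-dominating set if every vertex $v\notin D$ has some $u\in D$ with a directed path from $u$ to $v$ of length at most $k$. $\gamma_k(G)$ denotes the minimum cardinality of a distance $k$-dominating set of $G$. *)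

theory Defs
  imports Complex_Main "HOL-Number_Theory.Cong" "Graph_Theory.Arc_Walk"
begin

definition gen_de_bruijn :: "nat \<Rightarrow> nat \<Rightarrow> (nat, nat \<times> nat) pre_digraph" where
  "gen_de_bruijn n d =
     \<lparr> verts = {0..<n},
       arcs = {(x, y). x \<in> {0..<n} \<and> y \<in> {0..<n} \<and> (\<exists>i\<in>{0..<d}. [y = d * x + i] (mod n))},
       tail = fst,
       head = snd \<rparr>"

lemma fin_digraph_gen_de_bruijn: "fin_digraph (gen_de_bruijn n d)"
proof
  show "finite (arcs (gen_de_bruijn n d))"
    by (rule finite_subset[of _ "{0..<n} \<times> {0..<n}"]) (auto simp: gen_de_bruijn_def)
qed (auto simp: gen_de_bruijn_def)

lemma nomulti_digraph_gen_de_bruijn: "nomulti_digraph (gen_de_bruijn n d)"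
  by unfold_locales (auto simp: gen_de_bruijn_def arc_to_ends_def)

definition distance_dominating :: "('a, 'b) pre_digraph \<Rightarrow> nat \<Rightarrow> 'a set \<Rightarrow> bool" where
  "distance_dominating G k D \<longleftrightarrow>
     D \<subseteq> verts G \<and>
     (\<forall>v \<in> verts G - D. \<exists>u \<in> D. \<exists>p. pre_digraph.apath G u p v \<and> length p \<le> k)"

text \<open>Finiteness of \<open>D\<close> is automatic when \<open>verts G\<close> is finite; it is required
  because \<open>card\<close> is \<open>0\<close> on infinite sets.\<close>

definition distance_domination_number :: "('a, 'b) pre_digraph \<Rightarrow> nat \<Rightarrow> nat" where
  "distance_domination_number G k =
     (LEAST m. \<exists>D. distance_dominating G k D \<and> finite D \<and> card D = m)"

definition min_distance_dominating :: "('a, 'b) pre_digraph \<Rightarrow> nat \<Rightarrow> 'a set \<Rightarrow> bool" where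
  "min_distance_dominating G k D \<longleftrightarrow>
     distance_dominating G k D \<and> finite D \<and> card D = distance_domination_number G k"

end

theory Submission
  imports Defs
begin

text \<open>
  The vertices at the end of a walk of length \<open>j\<close> from \<open>u\<close> are the residues of
  \<open>d\<^sup>j u + r\<close> with \<open>0 \<le> r < d\<^sup>j\<close>. Hence each vertex dominates at most
  \<open>\<Sum>j\<le>k. d\<^sup>j\<close> vertices, which gives the lower bound. Conversely, write
  \<open>S\<^sub>j = \<Sum>i<j. d\<^sup>i\<close>. The vertices reached in \<open>j\<close> steps from the interval \<open>[x, x + c)\<close>
  form the interval of length \<open>d\<^sup>j c\<close> starting at
  \<open>d\<^sup>j x = x + (d - 1) x S\<^sub>j \<equiv> x + (c - h) S\<^sub>j\<close>. It ends at \<open>x + c S\<^bsub>j+1\<^esub> - h S\<^sub>j\<close>,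
  which because of \<open>h \<ge> 0\<close> is not before the start of the next interval. So the intervals for
  \<open>j \<le> k\<close> cover \<open>[x, x + c S\<^bsub>k+1\<^esub> - h S\<^sub>k)\<close>, and the upper bound on \<open>h\<close> says
  that this contains \<open>n\<close> consecutive integers.
\<close>

text \<open>Each step of \<open>awalk_to_apath\<close> cuts out a cycle. This lets walks, which have
  an arithmetic description, replace the paths in the definition of domination.\<close>

lemma (in wf_digraph) length_awalk_to_apath_le:
  assumes "awalk u p v"
  shows "length (awalk_to_apath p) \<le> length p"
  using assms
proof (induct rule: awalk_to_apath_induct)
  case (path p)
  then show ?case by (auto simp: awalk_to_apath.simps)
next
  case (decomp p q r s)
  then have "length (q @ s) \<le> length p"
    using awalk_cyc_decomp_has_prop[of u p v] by auto
  with decomp show ?case using step_awalk_to_apath[of u p v q r s] by simp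
qed

text \<open>Split off the first arc: its offset \<open>i < d\<close> and the offset
  \<open>r < d ^ j\<close> of the remaining walk combine to \<open>d ^ j * i + r\<close>, and by
  division with remainder these are exactly the numbers below \<open>d ^ Suc j\<close>.\<close>

lemma gen_de_bruijn_awalk_iff:
  assumes "n > 0"
  shows "(\<exists>p. pre_digraph.awalk (gen_de_bruijn n d) u p v \<and> length p = j) \<longleftrightarrow>
    u < n \<and> (\<exists>r<d ^ j. v = (d ^ j * u + r) mod n)"
proof (induction j arbitrary: u)
  case 0
  interpret fin_digraph "gen_de_bruijn n d" by (rule fin_digraph_gen_de_bruijn)
  show ?case
    by (auto simp: awalk_Nil_iff) (simp_all add: gen_de_bruijn_def)
next
  case (Suc j)
  interpret fin_digraph "gen_de_bruijn n d" by (rule fin_digraph_gen_de_bruijn)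
  have arc: "e \<in> arcs (gen_de_bruijn n d) \<and> u = tail (gen_de_bruijn n d) e \<and>
      head (gen_de_bruijn n d) e = w \<longleftrightarrow> e = (u, w) \<and> u < n \<and> (\<exists>i<d. w = (d * u + i) mod n)"
    for e w
    using assms by (cases e) (auto simp: gen_de_bruijn_def cong_def)
  have "(\<exists>p. awalk u p v \<and> length p = Suc j) \<longleftrightarrow>
      (\<exists>e p. awalk u (e # p) v \<and> length p = j)"
    by (metis length_Suc_conv)
  also have "\<dots> \<longleftrightarrow> (\<exists>w. (\<exists>e. e \<in> arcs (gen_de_bruijn n d) \<and>
      u = tail (gen_de_bruijn n d) e \<and> head (gen_de_bruijn n d) e = w) \<and>
      (\<exists>p. awalk w p v \<and> length p = j))"
    unfolding awalk_Cons_iff by blast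
  also have "\<dots> \<longleftrightarrow> u < n \<and> (\<exists>i<d. \<exists>r<d ^ j. v = (d ^ j * (d * u + i) + r) mod n)"
    (is "?L \<longleftrightarrow> _")
  proof -
    \<comment> \<open>Reducing the intermediate vertex modulo \<open>n\<close> does not change the
      residue reached.\<close>
    have "(d ^ j * ((d * u + i) mod n) + r) mod n = (d ^ j * (d * u + i) + r) mod n" for i r
      by (intro mod_add_cong mod_mult_right_eq refl)
    moreover have "(d * u + i) mod n < n" for i using assms by simp
    moreover have "?L \<longleftrightarrow> u < n \<and> (\<exists>i<d. (d * u + i) mod n < n \<and>
        (\<exists>r<d ^ j. v = (d ^ j * ((d * u + i) mod n) + r) mod n))"
      unfolding arc Suc.IH by blast
    ultimately show ?thesis by (simp only: simp_thms)
  qed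
  also have "\<dots> \<longleftrightarrow> u < n \<and> (\<exists>r<d ^ Suc j. v = (d ^ Suc j * u + r) mod n)"
  proof (intro conj_cong refl iffI)
    assume "\<exists>i<d. \<exists>r<d ^ j. v = (d ^ j * (d * u + i) + r) mod n"
    then obtain i r where ir: "i < d" "r < d ^ j" "v = (d ^ j * (d * u + i) + r) mod n"
      by blast
    have "d ^ j * i + r < d ^ j * Suc i" using ir by simp
    also have "\<dots> \<le> d ^ j * d" using ir by (intro mult_le_mono) auto
    finally have "d ^ j * i + r < d ^ Suc j" by (simp add: mult.commute)
    moreover have "v = (d ^ Suc j * u + (d ^ j * i + r)) mod n"
      using ir by (simp add: algebra_simps)
    ultimately show "\<exists>r<d ^ Suc j. v = (d ^ Suc j * u + r) mod n" by blast
  next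
    assume "\<exists>r<d ^ Suc j. v = (d ^ Suc j * u + r) mod n"
    then obtain r where r: "r < d ^ Suc j" "v = (d ^ Suc j * u + r) mod n" by blast
    have "r div d ^ j < d" using r by (simp add: less_mult_imp_div_less)
    moreover have "r mod d ^ j < d ^ j" using r by (cases "d = 0") auto
    moreover have "d ^ j * (d * u + r div d ^ j) + r mod d ^ j = d ^ Suc j * u + r"
      by (simp add: algebra_simps)
    ultimately show "\<exists>i<d. \<exists>r<d ^ j. v = (d ^ j * (d * u + i) + r) mod n"
      using r(2) by metis
  qed
  finally show ?case .
qed

lemma gen_de_bruijn_apath_iff:
  assumes "n > 0"
  shows "(\<exists>p. pre_digraph.apath (gen_de_bruijn n d) u p v \<and> length p \<le> k) \<longleftrightarrow>
    u < n \<and> (\<exists>j\<le>k. \<exists>r<d ^ j. v = (d ^ j * u + r) mod n)"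
proof -
  interpret fin_digraph "gen_de_bruijn n d" by (rule fin_digraph_gen_de_bruijn)
  have "(\<exists>p. apath u p v \<and> length p \<le> k) \<longleftrightarrow> (\<exists>p. awalk u p v \<and> length p \<le> k)"
    by (meson apath_awalk_to_apath awalkI_apath length_awalk_to_apath_le le_trans)
  also have "\<dots> \<longleftrightarrow> (\<exists>j\<le>k. \<exists>p. awalk u p v \<and> length p = j)"
    by blast
  finally show ?thesis
    unfolding gen_de_bruijn_awalk_iff[OF assms] by blast
qed

text \<open>A vertex of \<open>D\<close> reaches itself with \<open>j = 0\<close> and
  \<open>r = 0\<close>, so the condition may range over all vertices instead of those outside
  \<open>D\<close>.\<close>

lemma distance_dominating_gen_de_bruijn_iff:
  assumes "n > 0"
  shows "distance_dominating (gen_de_bruijn n d) k D \<longleftrightarrow>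
    D \<subseteq> {..<n} \<and> (\<forall>v<n. \<exists>u\<in>D. \<exists>j\<le>k. \<exists>r<d ^ j. v = (d ^ j * u + r) mod n)"
proof -
  have "\<exists>u\<in>D. \<exists>j\<le>k. \<exists>r<d ^ j. v = (d ^ j * u + r) mod n" if "v \<in> D" "v < n" for v
    using that by (intro bexI[of _ v] exI[of _ 0]) auto
  moreover have "verts (gen_de_bruijn n d) = {..<n}"
    by (auto simp: gen_de_bruijn_def)
  ultimately show ?thesis
    unfolding distance_dominating_def gen_de_bruijn_apath_iff[OF assms] by blast
qed

lemma distance_dominating_gen_de_bruijn_card_ge:
  assumes "n > 0" and "distance_dominating (gen_de_bruijn n d) k D"
  shows "n \<le> card D * (\<Sum>j=0..k. d ^ j)"
proof -
  \<comment> \<open>\<open>R u\<close> is the ball of vertices within distance \<open>k\<close> from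
    \<open>u\<close>; the balls around \<open>D\<close> cover the digraph.\<close>
  define R where "R u = (\<Union>j\<in>{0..k}. (\<lambda>r. (d ^ j * u + r) mod n) ` {..<d ^ j})" for u
  have D: "D \<subseteq> {..<n}" "{..<n} \<subseteq> (\<Union>u\<in>D. R u)"
    using assms(2) unfolding distance_dominating_gen_de_bruijn_iff[OF assms(1)] R_def
    by (blast, fastforce)
  have "finite D" using D(1) finite_subset by blast
  have "card (R u) \<le> (\<Sum>j=0..k. d ^ j)" for u
  proof -
    have "card (R u) \<le> (\<Sum>j=0..k. card ((\<lambda>r. (d ^ j * u + r) mod n) ` {..<d ^ j}))"
      unfolding R_def by (rule card_UN_le) simp
    also have "\<dots> \<le> (\<Sum>j=0..k. d ^ j)"
      by (intro sum_mono) (metis card_image_le card_lessThan finite_lessThan)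
    finally show ?thesis .
  qed
  then have "(\<Sum>u\<in>D. card (R u)) \<le> card D * (\<Sum>j=0..k. d ^ j)"
    using sum_bounded_above[of D "\<lambda>u. card (R u)"] by simp
  moreover have "card (\<Union>u\<in>D. R u) \<le> (\<Sum>u\<in>D. card (R u))"
    using \<open>finite D\<close> by (rule card_UN_le)
  moreover have "n \<le> card (\<Union>u\<in>D. R u)"
    using card_mono[OF _ D(2)] \<open>finite D\<close> by (simp add: R_def)
  ultimately show ?thesis by linarith
qed

text \<open>Induction on \<open>k\<close>: if \<open>m\<close> is not below \<open>e k\<close>, then
  \<open>a (Suc k) \<le> e k \<le> m\<close>, so the last interval contains
  \<open>m\<close>.\<close>

lemma interval_covered_by_chain:
  fixes a e :: "nat \<Rightarrow> 'a::linorder"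
  assumes "\<And>j. a (Suc j) \<le> e j" and "a 0 \<le> m" and "m < e k"
  shows "\<exists>j\<le>k. a j \<le> m \<and> m < e j"
  using assms(3)
proof (induction k)
  case 0
  with assms(2) show ?case by auto
next
  case (Suc k)
  show ?case
  proof (cases "m < e k")
    case True
    with Suc.IH show ?thesis using le_SucI by blast
  next
    case False
    with assms(1)[of k] Suc.prems show ?thesis by (intro exI[of _ "Suc k"]) auto
  qed
qed

lemma distance_dominating_gen_de_bruijn_interval:
  fixes d n k c x :: nat and h :: int
  assumes "n > 0" and "d > 0" and "h \<ge> 0"
    and cong: "[(int d - 1) * int x = int c - h] (mod int n)"
    and bound: "(\<Sum>j<k. int d ^ j) * h \<le> (\<Sum>j\<le>k. int d ^ j) * int c - int n"
  shows "distance_dominating (gen_de_bruijn n d) k ((\<lambda>i. (x + i) mod n) ` {0..<c})"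
  unfolding distance_dominating_gen_de_bruijn_iff[OF assms(1)]
proof (intro conjI allI impI)
  show "(\<lambda>i. (x + i) mod n) ` {0..<c} \<subseteq> {..<n}" using assms(1) by auto
next
  fix v assume v: "v < n"
  define S where "S j = (\<Sum>i<j. int d ^ i)" for j
  \<comment> \<open>This representative of \<open>d ^ j * x\<close> modulo \<open>n\<close> places
    the intervals so that they leave no gaps. Integers are used because \<open>c - h\<close> may be
    negative.\<close>
  define a where "a j = int x + (int c - h) * S j" for j
  define e where "e j = a j + int d ^ j * int c" for j
  \<comment> \<open>The representative of \<open>v\<close> in the window
    \<open>[x, x + n)\<close>.\<close>
  define m where "m = int x + (int v - int x) mod int n"
  have S0: "S 0 = 0" and S_Suc: "S (Suc j) = S j + int d ^ j" for j
    by (simp_all add: S_def)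
  have e: "e j = int x + int c * S (Suc j) - h * S j" for j
    by (simp add: e_def a_def S_Suc algebra_simps)
  have "a (Suc j) \<le> e j" for j
    using \<open>h \<ge> 0\<close> by (simp add: e a_def S_Suc algebra_simps)
  moreover have "a 0 \<le> m"
    using assms(1) by (simp add: a_def S0 m_def)
  moreover have "m < e k"
  proof -
    have "S k * h \<le> S (Suc k) * int c - int n"
      using bound by (simp add: S_def lessThan_Suc_atMost)
    moreover have "m < int x + int n" using assms(1) by (simp add: m_def)
    ultimately show ?thesis by (simp add: e algebra_simps)
  qed
  ultimately obtain j where j: "j \<le> k" "a j \<le> m" "m < e j"
    using interval_covered_by_chain[of a e m k] by blast
  have geom: "int d ^ j = (int d - 1) * S j + 1"
    using power_diff_1_eq[of "int d" j] by (simp add: S_def)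
  have a_cong: "[int d ^ j * int x = a j] (mod int n)"
  proof -
    have "int d ^ j * int x = int x + (int d - 1) * int x * S j"
      by (simp add: geom algebra_simps)
    then show ?thesis
      using cong unfolding a_def by (simp add: cong_add cong_mult)
  qed
  \<comment> \<open>The position of \<open>m\<close> in the \<open>j\<close>-th interval, which
    consists of \<open>c\<close> blocks of length \<open>d ^ j\<close>: the quotient of
    \<open>t\<close> by \<open>d ^ j\<close> selects the vertex of \<open>D\<close>, the remainder
    the walk starting there.\<close>
  define t where "t = nat (m - a j)"
  have t: "int t = m - a j" using j by (simp add: t_def)
  have "int t < int (d ^ j * c)" using j(3) t by (simp add: e_def)
  then have "t < c * d ^ j" by (simp only: of_nat_less_iff mult.commute)
  then have i: "t div d ^ j < c" by (rule less_mult_imp_div_less)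
  have r: "t mod d ^ j < d ^ j" using assms(2) by simp
  have "[int v = m] (mod int n)"
    by (simp add: m_def cong_def mod_simps)
  also have "m = a j + int t" by (simp add: t)
  also have "[a j + int t = int d ^ j * int x + int t] (mod int n)"
    using a_cong by (simp add: cong_add cong_sym)
  also have "int d ^ j * int x + int t = int (d ^ j * x + t)"
    by simp
  finally have "[v = d ^ j * x + t] (mod n)"
    by (simp only: cong_int_iff)
  also have "d ^ j * x + t = d ^ j * (x + t div d ^ j) + t mod d ^ j"
    by (simp add: algebra_simps)
  finally have "v = (d ^ j * (x + t div d ^ j) + t mod d ^ j) mod n"
    using v by (simp only: cong_def mod_less)
  also have "\<dots> = (d ^ j * ((x + t div d ^ j) mod n) + t mod d ^ j) mod n"
    by (intro mod_add_cong mod_mult_right_eq[symmetric] refl)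
  finally have "v = (d ^ j * ((x + t div d ^ j) mod n) + t mod d ^ j) mod n" .
  with i r j(1) show "\<exists>u\<in>(\<lambda>i. (x + i) mod n) ` {0..<c}. \<exists>j\<le>k. \<exists>r<d ^ j.
      v = (d ^ j * u + r) mod n"
    by (intro bexI[of _ "(x + t div d ^ j) mod n"]) auto
qed

theorem theorem2p2:
  fixes d n k c x :: nat and h :: int
  assumes "d \<ge> 2" and "n \<ge> d" and "k \<ge> 1"
    and "c = nat \<lceil>real n / real (\<Sum>j=0..k. d ^ j)\<rceil>"
    and "x \<in> verts (gen_de_bruijn n d)"
    and "[(int d - 1) * int x = int c - h] (mod int n)"
    and "0 \<le> (\<Sum>j=0..k-1. int d ^ j) * h"
    and "(\<Sum>j=0..k-1. int d ^ j) * h \<le> (\<Sum>j=0..k. int d ^ j) * int c - int n"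
  shows "distance_domination_number (gen_de_bruijn n d) k = c
       \<and> min_distance_dominating (gen_de_bruijn n d) k ((\<lambda>i. (x + i) mod n) ` {0..<c})"
proof -
  let ?G = "gen_de_bruijn n d" and ?D = "(\<lambda>i. (x + i) mod n) ` {0..<c}"
  have n: "n > 0" using assms by simp
  have "{0..k-1} = {..<k}" using assms(3) by auto
  moreover have "(\<Sum>j=0..k-1. int d ^ j) > 0"
    using assms(1) by (intro sum_pos) auto
  then have "h \<ge> 0" using assms(7) by (simp add: zero_le_mult_iff)
  ultimately have dom: "distance_dominating ?G k ?D"
    using assms n by (intro distance_dominating_gen_de_bruijn_interval)
      (auto simp: atMost_atLeast0)
  have lower: "c \<le> card D" if "distance_dominating ?G k D" for D
  proof -
    have pos: "(\<Sum>j=0..k. d ^ j) > 0"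
      using assms(1) by (intro sum_pos) auto
    have "real n \<le> real (card D) * real (\<Sum>j=0..k. d ^ j)"
      using distance_dominating_gen_de_bruijn_card_ge[OF n that]
      by (metis of_nat_le_iff of_nat_mult)
    then have "real n / real (\<Sum>j=0..k. d ^ j) \<le> real (card D)"
      using pos by (subst pos_divide_le_eq) (simp_all del: of_nat_sum)
    then show ?thesis
      unfolding assms(4) by (simp add: nat_le_iff ceiling_le_iff del: of_nat_sum)
  qed
  \<comment> \<open>The lower bound applied to \<open>?D\<close> itself shows that the
    \<open>c\<close> residues are distinct.\<close>
  have card: "card ?D = c"
    using lower[OF dom] card_image_le[of "{0..<c}" "\<lambda>i. (x + i) mod n"] by simp
  have "distance_domination_number ?G k = c"
    unfolding distance_domination_number_def
    using dom card lower by (intro Least_equality) auto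
  with dom card show ?thesis
    by (simp add: min_distance_dominating_def)
qed

end
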